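(* Let $d\in\mathbb{N}$, $d\ge 1$. For any compact set $F\subset\mathbb{R}^d$, the gallery $\mathcal{G}_F$ contains a singleton if and only if $\dim_{\mathrm{L}} F=0$.
   Context: For a bounded set $A\subset\mathbb{R}^d$ and $r>0$, $N_r(A)$ is the smallest number of cubes of side length $r$ needed to cover $A$. $B(x,R)$ is the closed ball of centre $x$ and radius $R$. The lower dimension is \[ \dim_{\mathrm{L}} F=\sup\Big\{s\ge 0: \exists C>0\ \forall\, 0<R<1\ \forall\, r\in(0,R)\ \forall x\in F:\ N_r(B(x,R)\cap F)\ge C\big(\tfrac{R}{r}\big)^s\Big\}. \] Let $X=[0,1]^d$ and let $\mathcal{K}(X)$ be the space of nonempty compact subsets of $X$ with the Hausdorff metric. A set $D\in\mathcal{K}(X)$ is a miniset of a compact set $F\subset\mathbb{R}^d$ if $D=(\lambda F+t)\cap X$ for some $\lambda\ge 1$ and $t\in\mathbb{R}^d$. A set $E\in\mathcal{K}(X)$ is a microset of $F$ if it is a limit, in the Hausdorff metric, of a sequence of minisets of $F$ (the scaling coefficients $\lambda$ are not required to be unbounded along the sequence). The gallery $\mathcal{G}_F$ is the collection of all microsets of $F$ which intersect the interior $(0,1)^d$ of $X$. *)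

theory Defs
  imports "HOL-Analysis.Analysis"
begin

(* Cubes are closed and axis-parallel; the vector 1 :: real^'n has all coordinates equal to 1. *)
definition is_cube :: "real \<Rightarrow> (real^'n) set \<Rightarrow> bool" where
  "is_cube r Q \<longleftrightarrow> (\<exists>a. Q = cbox a (a + r *\<^sub>R 1))"

definition covering_number :: "real \<Rightarrow> (real^'n) set \<Rightarrow> nat" where
  "covering_number r A =
     (LEAST k. \<exists>\<Q>. finite \<Q> \<and> card \<Q> = k \<and> (\<forall>Q\<in>\<Q>. is_cube r Q) \<and> A \<subseteq> \<Union>\<Q>)"

(* The supremum is taken in the extended reals, so that the empty set, for which
   every exponent s is admissible, has lower dimension \<infinity>. *)
definition lower_dim :: "(real^'n) set \<Rightarrow> ereal" where
  "lower_dim F =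
     Sup {ereal s | s. 0 \<le> s \<and>
       (\<exists>C>0. \<forall>R r. 0 < R \<longrightarrow> R < 1 \<longrightarrow> 0 < r \<longrightarrow> r < R \<longrightarrow>
          (\<forall>x\<in>F. real (covering_number r (cball x R \<inter> F)) \<ge> C * (R / r) powr s))}"

definition unit_cube :: "(real^'n) set" where
  "unit_cube = cbox 0 1"

definition cpt_space :: "(real^'n) set set" where
  "cpt_space = {A. A \<noteq> {} \<and> compact A \<and> A \<subseteq> unit_cube}"

(* A metric only on nonempty compact sets; it is used for members of cpt_space. *)
definition hausdorff_dist :: "'a::metric_space set \<Rightarrow> 'a set \<Rightarrow> real" where
  "hausdorff_dist A B = max (SUP a\<in>A. infdist a B) (SUP b\<in>B. infdist b A)"

definition is_miniset :: "(real^'n) set \<Rightarrow> (real^'n) set \<Rightarrow> bool" where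
  "is_miniset F D \<longleftrightarrow>
     D \<in> cpt_space \<and> (\<exists>l\<ge>1. \<exists>t. D = (\<lambda>x. l *\<^sub>R x + t) ` F \<inter> unit_cube)"

definition is_microset :: "(real^'n) set \<Rightarrow> (real^'n) set \<Rightarrow> bool" where
  "is_microset F E \<longleftrightarrow>
     E \<in> cpt_space \<and>
     (\<exists>D :: nat \<Rightarrow> (real^'n) set. (\<forall>n. is_miniset F (D n)) \<and>
        (\<lambda>n. hausdorff_dist (D n) E) \<longlonglongrightarrow> 0)"

definition gallery :: "(real^'n) set \<Rightarrow> (real^'n) set set" where
  "gallery F = {E. is_microset F E \<and> E \<inter> interior unit_cube \<noteq> {}}"

end

theory Submission
  imports Defs
begin

text \<open>
  Both sides of the equivalence say that \<^term>\<open>F\<close> fails to be uniformly perfect: at arbitrarily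
  small relative precision \<open>\<epsilon>\<close> there are a point \<open>y \<in> F\<close> and a radius \<open>\<rho> < 1\<close> for which the annulus
  between the spheres of radii \<open>\<epsilon> * \<rho>\<close> and \<open>\<rho>\<close> about \<open>y\<close> misses \<open>F\<close>.

  For the gallery this is a matter of magnification.  A miniset that is Hausdorff-close to a
  singleton inside the open cube is concentrated near an interior point of the cube, and undoing the
  magnification gives an empty annulus in \<open>F\<close>; here interiority guarantees that a whole ball of \<open>F\<close>
  has been seen.  Conversely an empty annulus can be magnified until its outer ball covers the cube,
  with \<open>y\<close> at the centre, so that these minisets converge to the centre of the cube as \<open>\<epsilon>\<close> tends
  to \<open>0\<close>.

  For the lower dimension, an empty annulus means that a single cube of side \<open>2 * \<epsilon> *
  \<rho>\<close> covers the part of \<open>F\<close> in a ball of radius \<open>\<rho>\<close>, which rules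
  out every exponent \<open>s > 0\<close> as \<open>\<epsilon>\<close> tends to \<open>0\<close>. If
  \<open>F\<close> is uniformly perfect, every ball centred in \<open>F\<close> of radius below
  \<open>1\<close> contains two well separated smaller balls centred in \<open>F\<close> of a fixed relative
  size \<open>c\<close>. Iterating this (\<open>uniformly_perfect_separated_points\<close>) produces
  \<open>2 ^ k\<close> points of \<open>F\<close> in a ball of radius \<open>R\<close> at mutual distances
  above \<open>c ^ k * R\<close>, as in a Cantor set, and hence the positive exponent \<open>ln 2 / ln (1 /
  c)\<close>.
\<close>

section \<open>Covering numbers by cubes\<close>

lemma dist_le_of_mem_cube:
  fixes p q :: "real^'n"
  assumes "is_cube r Q" "p \<in> Q" "q \<in> Q"
  shows "dist p q \<le> r * norm (1 :: real^'n)"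
proof -
  obtain a where a: "Q = cbox a (a + r *\<^sub>R 1)"
    using assms(1) by (auto simp: is_cube_def)
  have "a $ i \<le> p $ i \<and> p $ i \<le> a $ i + r \<and> a $ i \<le> q $ i \<and> q $ i \<le> a $ i + r" for i
    using assms(2,3) unfolding a mem_box_cart by auto
  then have le: "\<bar>p $ i - q $ i\<bar> \<le> r \<and> 0 \<le> r" for i
    by (smt (verit))
  then have "norm (p - q) \<le> norm (r *\<^sub>R (1 :: real^'n))"
    by (intro norm_le_componentwise_cart) (auto simp: abs_of_nonneg)
  then show ?thesis
    using le by (simp add: dist_norm)
qed

lemma cball_subset_cube:
  fixes x :: "real^'n"
  obtains Q where "is_cube (2 * e) Q" "cball x e \<subseteq> Q"
proof
  show "is_cube (2 * e) (cbox (x - e *\<^sub>R 1) (x - e *\<^sub>R 1 + (2 * e) *\<^sub>R 1))"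
    by (auto simp: is_cube_def)
  show "cball x e \<subseteq> cbox (x - e *\<^sub>R 1) (x - e *\<^sub>R 1 + (2 * e) *\<^sub>R 1)"
  proof
    fix y assume "y \<in> cball x e"
    then have "norm (y - x) \<le> e" by (simp add: dist_norm norm_minus_commute)
    then have "\<bar>y $ i - x $ i\<bar> \<le> e" for i
      using component_le_norm_cart[of "y - x" i] by simp
    then show "y \<in> cbox (x - e *\<^sub>R 1) (x - e *\<^sub>R 1 + (2 * e) *\<^sub>R 1)"
      unfolding mem_box_cart by (simp add: abs_le_iff) (smt (verit))
  qed
qed

lemma covering_number_le_1:
  assumes "is_cube r Q" "A \<subseteq> Q"
  shows "covering_number r A \<le> 1"
  unfolding covering_number_def
  by (rule Least_le, rule exI[of _ "{Q}"]) (use assms in auto)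

text \<open>The covering number is a least element, which carries information only when some finite cover
  exists; total boundedness of compact sets provides one.\<close>

lemma covering_number_attained:
  fixes A :: "(real^'n) set"
  assumes "compact A" "r > 0"
  obtains \<Q> where "finite \<Q>" "card \<Q> = covering_number r A" "\<forall>Q\<in>\<Q>. is_cube r Q" "A \<subseteq> \<Union>\<Q>"
proof -
  obtain k where k: "finite k" "A \<subseteq> (\<Union>x\<in>k. ball x (r / 2))"
    using assms compact_eq_totally_bounded[of A] by (metis half_gt_zero)
  have "\<exists>Q. is_cube r Q \<and> cball x (r / 2) \<subseteq> Q" for x :: "real^'n"
    by (metis cball_subset_cube[of "r / 2" x] field_sum_of_halves mult_2)
  then obtain Q where Q: "\<And>x::real^'n. is_cube r (Q x) \<and> cball x (r / 2) \<subseteq> Q x"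
    by metis
  let ?P = "\<lambda>k. \<exists>\<Q>. finite \<Q> \<and> card \<Q> = k \<and> (\<forall>Q\<in>\<Q>. is_cube r Q) \<and> A \<subseteq> \<Union>\<Q>"
  have "A \<subseteq> \<Union>(Q ` k)"
  proof
    fix a assume "a \<in> A"
    then obtain x where "x \<in> k" "a \<in> ball x (r / 2)" using k(2) by blast
    moreover from this have "a \<in> Q x" using Q[of x] by auto
    ultimately show "a \<in> \<Union>(Q ` k)" by blast
  qed
  then have "?P (card (Q ` k))"
    using k(1) Q by (intro exI[of _ "Q ` k"]) auto
  then have "?P (covering_number r A)"
    unfolding covering_number_def by (rule LeastI)
  then show ?thesis using that by blast
qed

text \<open>A cube contains at most one point of a set whose points are further apart than its diameter.\<close>

lemma card_separated_le_covering_number: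
  fixes A :: "(real^'n) set"
  assumes "compact A" "r > 0" "S \<subseteq> A"
    and sep: "\<And>p q. p \<in> S \<Longrightarrow> q \<in> S \<Longrightarrow> p \<noteq> q \<Longrightarrow> r * norm (1 :: real^'n) < dist p q"
  shows "card S \<le> covering_number r A"
proof -
  obtain \<Q> where \<Q>: "finite \<Q>" "card \<Q> = covering_number r A" "\<forall>Q\<in>\<Q>. is_cube r Q" "A \<subseteq> \<Union>\<Q>"
    using covering_number_attained assms by metis
  then have "\<forall>p\<in>S. \<exists>Q\<in>\<Q>. p \<in> Q"
    using assms(3) by blast
  then obtain Q where Q: "\<And>p. p \<in> S \<Longrightarrow> Q p \<in> \<Q> \<and> p \<in> Q p"
    by metis
  have "inj_on Q S"
    by (rule inj_onI) (metis Q \<Q>(3) dist_le_of_mem_cube not_less sep)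
  then have "card S \<le> card \<Q>"
    using Q \<Q>(1) by (intro card_inj_on_le[of Q]) auto
  then show ?thesis using \<Q>(2) by simp
qed

lemma covering_number_ge_1:
  fixes A :: "(real^'n) set"
  assumes "compact A" "r > 0" "A \<noteq> {}"
  shows "1 \<le> covering_number r A"
proof -
  obtain x where "x \<in> A" using assms(3) by blast
  then show ?thesis
    using card_separated_le_covering_number[of A r "{x}"] assms by auto
qed

section \<open>Uniform perfectness below scale one\<close>

text \<open>Only radii below \<open>1\<close> are tested, matching the scales that enter the lower dimension.  The empty
  set is uniformly perfect, in accordance with its infinite lower dimension and empty gallery.\<close>

definition uniformly_perfect :: "'a::metric_space set \<Rightarrow> bool" where
  "uniformly_perfect F \<longleftrightarrow>
     (\<exists>\<epsilon>>0. \<forall>y\<in>F. \<forall>\<rho>. 0 < \<rho> \<longrightarrow> \<rho> < 1 \<longrightarrow> (\<exists>z\<in>F. \<epsilon> * \<rho> < dist y z \<and> dist y z \<le> \<rho>))"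

lemma not_uniformly_perfectE:
  assumes "\<not> uniformly_perfect F" "\<epsilon> > 0"
  obtains y \<rho> where "y \<in> F" "0 < \<rho>" "\<rho> < 1" "F \<inter> cball y \<rho> \<subseteq> cball y (\<epsilon> * \<rho>)"
proof -
  obtain y \<rho> where "y \<in> F" "0 < \<rho>" "\<rho> < 1" "\<not> (\<exists>z\<in>F. \<epsilon> * \<rho> < dist y z \<and> dist y z \<le> \<rho>)"
    using assms unfolding uniformly_perfect_def by blast
  then show ?thesis
    by (intro that[of y \<rho>]) auto
qed

text \<open>One step of the Cantor-type construction: in \<open>cball y \<rho>\<close> choose a point \<open>z\<close> with
  \<open>4 * c * \<rho> < dist y z \<le> \<rho> / 2\<close>.  The balls of radius \<open>c * \<rho>\<close> about \<open>y\<close> and \<open>z\<close> stay inside the given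
  ball and are more than \<open>2 * c * \<rho>\<close> apart, so the construction repeats in both of them.\<close>

lemma uniformly_perfect_separated_points:
  fixes F :: "'a::metric_space set"
  assumes "uniformly_perfect F"
  obtains c where "0 < c" "c < 1"
    "\<And>k y \<rho>. y \<in> F \<Longrightarrow> 0 < \<rho> \<Longrightarrow> \<rho> < 1 \<Longrightarrow>
       \<exists>S \<subseteq> F \<inter> cball y \<rho>. card S = 2 ^ k \<and> (\<forall>p\<in>S. \<forall>q\<in>S. p \<noteq> q \<longrightarrow> c ^ k * \<rho> < dist p q)"
proof -
  obtain e where e: "e > 0"
    "\<And>y \<rho>. y \<in> F \<Longrightarrow> 0 < \<rho> \<Longrightarrow> \<rho> < 1 \<Longrightarrow> \<exists>z\<in>F. e * \<rho> < dist y z \<and> dist y z \<le> \<rho>"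
    using assms unfolding uniformly_perfect_def by blast
  define c where "c = min (e / 8) (1 / 8)"
  have c: "0 < c" "c \<le> 1 / 8" "8 * c \<le> e"
    using e(1) by (auto simp: c_def)
  have "\<exists>S \<subseteq> F \<inter> cball y \<rho>. finite S \<and> card S = 2 ^ k \<and>
          (\<forall>p\<in>S. \<forall>q\<in>S. p \<noteq> q \<longrightarrow> c ^ k * \<rho> < dist p q)"
    if "y \<in> F" "0 < \<rho>" "\<rho> < 1" for k y \<rho>
    using that
  proof (induction k arbitrary: y \<rho>)
    case 0
    then show ?case by (intro exI[of _ "{y}"]) auto
  next
    case (Suc k)
    let ?\<sigma> = "c * \<rho>"
    have \<sigma>: "0 < ?\<sigma>" "?\<sigma> \<le> \<rho> / 8"
      using c Suc.prems mult_right_mono[of c "1 / 8" \<rho>] by auto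
    then have \<sigma>1: "?\<sigma> < 1"
      using Suc.prems by linarith
    obtain z where z: "z \<in> F" "e * (\<rho> / 2) < dist y z" "dist y z \<le> \<rho> / 2"
      using e(2)[of y "\<rho> / 2"] Suc.prems by auto
    have "8 * c * (\<rho> / 2) \<le> e * (\<rho> / 2)"
      using c(3) Suc.prems by (intro mult_right_mono) auto
    then have far: "4 * ?\<sigma> < dist y z"
      using z(2) by (simp add: mult.commute)
    obtain S where S: "S \<subseteq> F \<inter> cball y ?\<sigma>" "finite S" "card S = 2 ^ k"
      "\<And>p q. p \<in> S \<Longrightarrow> q \<in> S \<Longrightarrow> p \<noteq> q \<Longrightarrow> c ^ k * ?\<sigma> < dist p q"
      using Suc.IH[of y ?\<sigma>] Suc.prems \<sigma> \<sigma>1 by metis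
    obtain T where T: "T \<subseteq> F \<inter> cball z ?\<sigma>" "finite T" "card T = 2 ^ k"
      "\<And>p q. p \<in> T \<Longrightarrow> q \<in> T \<Longrightarrow> p \<noteq> q \<Longrightarrow> c ^ k * ?\<sigma> < dist p q"
      using Suc.IH[of z ?\<sigma>] z \<sigma> \<sigma>1 by metis
    have "c ^ k \<le> 1"
      using c by (intro power_le_one) auto
    then have small: "c ^ k * ?\<sigma> \<le> ?\<sigma>"
      using mult_right_mono[of "c ^ k" 1 ?\<sigma>] \<sigma> by simp
    have cross: "c ^ k * ?\<sigma> < dist p q \<and> c ^ k * ?\<sigma> < dist q p" if "p \<in> S" "q \<in> T" for p q
    proof -
      have "dist y p \<le> ?\<sigma>" "dist z q \<le> ?\<sigma>"
        using that S(1) T(1) by auto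
      moreover have "dist y z \<le> dist y p + dist p q + dist z q"
        by metric
      ultimately show ?thesis
        using far small \<sigma> by (simp add: dist_commute)
    qed
    have "S \<inter> T = {}"
    proof (rule ccontr)
      assume "S \<inter> T \<noteq> {}"
      then obtain p where "p \<in> S" "p \<in> T" by blast
      then have "c ^ k * ?\<sigma> < 0" using cross[of p p] by simp
      moreover have "0 < c ^ k * ?\<sigma>" using c \<sigma> by simp
      ultimately show False by linarith
    qed
    then have "card (S \<union> T) = 2 ^ Suc k"
      using S T by (simp add: card_Un_disjoint)
    moreover have "S \<union> T \<subseteq> F \<inter> cball y \<rho>"
    proof
      fix p assume "p \<in> S \<union> T"
      then consider "p \<in> F" "dist y p \<le> ?\<sigma>" | "p \<in> F" "dist z p \<le> ?\<sigma>"
        unfolding mem_cball[symmetric] using S(1) T(1) by blast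
      then show "p \<in> F \<inter> cball y \<rho>"
      proof cases
        case 1
        moreover from this have "dist y p \<le> \<rho>" using \<sigma> Suc.prems by linarith
        ultimately show ?thesis by simp
      next
        case 2
        moreover from this have "dist y p \<le> \<rho>"
          using \<sigma> z(3) Suc.prems dist_triangle[of y p z] by linarith
        ultimately show ?thesis by simp
      qed
    qed
    moreover have "\<forall>p\<in>S \<union> T. \<forall>q\<in>S \<union> T. p \<noteq> q \<longrightarrow> c ^ Suc k * \<rho> < dist p q"
      using S(4) T(4) cross by (auto simp: mult.assoc mult.left_commute)
    ultimately show ?case
      using S(2) T(2) by (intro exI[of _ "S \<union> T"]) auto
  qed
  then have "\<exists>S \<subseteq> F \<inter> cball y \<rho>. card S = 2 ^ k \<and> (\<forall>p\<in>S. \<forall>q\<in>S. p \<noteq> q \<longrightarrow> c ^ k * \<rho> < dist p q)"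
    if "y \<in> F" "0 < \<rho>" "\<rho> < 1" for k y \<rho>
    using that by metis
  moreover have "c < 1" using c by simp
  ultimately show ?thesis using that[of c] c(1) by blast
qed

section \<open>Lower dimension\<close>

lemma lower_dim_nonneg:
  fixes F :: "(real^'n) set"
  assumes "compact F"
  shows "0 \<le> lower_dim F"
proof -
  have "1 * (R / r) powr 0 \<le> real (covering_number r (cball x R \<inter> F))"
    if "0 < R" "0 < r" "x \<in> F" for R r x
  proof -
    have "1 \<le> covering_number r (cball x R \<inter> F)"
      using that assms
      by (intro covering_number_ge_1) (auto simp: compact_Int ex_in_conv[symmetric] intro: exI[of _ x])
    then show ?thesis using that by simp
  qed
  then have "ereal 0 \<le> lower_dim F"
    unfolding lower_dim_def by (intro Sup_upper CollectI exI[of _ 0] conjI exI[of _ 1]) auto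
  then show ?thesis by (simp add: zero_ereal_def)
qed

lemma lower_dim_eq_0_if_not_uniformly_perfect:
  fixes F :: "(real^'n) set"
  assumes "compact F" "\<not> uniformly_perfect F"
  shows "lower_dim F = 0"
proof (rule antisym)
  have "s = 0" if s: "0 \<le> s" and C: "C > 0"
    and lower: "\<And>R r x. 0 < R \<Longrightarrow> R < 1 \<Longrightarrow> 0 < r \<Longrightarrow> r < R \<Longrightarrow> x \<in> F \<Longrightarrow>
      C * (R / r) powr s \<le> real (covering_number r (cball x R \<inter> F))" for s C
  proof (rule ccontr)
    assume "s \<noteq> 0"
    then have s: "s > 0" using s by simp
    \<comment> \<open>A ratio of radii so large that the assumed lower bound is at least \<open>2\<close>.\<close>
    define K where "K = max 2 ((2 / C) powr (1 / s))"
    have K: "K \<ge> 2" by (simp add: K_def)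
    have "2 / C = ((2 / C) powr (1 / s)) powr s"
      using s C by (simp add: powr_powr)
    also have "\<dots> \<le> K powr s"
      using s by (intro powr_mono2) (auto simp: K_def)
    finally have big: "2 \<le> C * K powr s"
      using C by (simp add: field_simps)
    obtain y \<rho> where y: "y \<in> F" "0 < \<rho>" "\<rho> < 1" "F \<inter> cball y \<rho> \<subseteq> cball y (1 / (2 * K) * \<rho>)"
      using not_uniformly_perfectE[OF assms(2), of "1 / (2 * K)"] K by auto
    let ?r = "2 * (1 / (2 * K) * \<rho>)"
    obtain Q where "is_cube ?r Q" "cball y (1 / (2 * K) * \<rho>) \<subseteq> Q"
      by (rule cball_subset_cube)
    then have "covering_number ?r (cball y \<rho> \<inter> F) \<le> 1"
      using y(4) by (intro covering_number_le_1[of _ Q]) auto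
    moreover have "C * (\<rho> / ?r) powr s \<le> real (covering_number ?r (cball y \<rho> \<inter> F))"
      using y K by (intro lower) (auto simp: field_simps)
    moreover have "\<rho> / ?r = K"
      using y K by (simp add: field_simps)
    ultimately show False
      using big by simp
  qed
  then show "lower_dim F \<le> 0"
    unfolding lower_dim_def by (intro Sup_least) (force simp: zero_ereal_def)
qed (rule lower_dim_nonneg[OF assms(1)])

lemma lower_dim_pos_if_uniformly_perfect:
  fixes F :: "(real^'n) set"
  assumes "compact F" "uniformly_perfect F"
  shows "0 < lower_dim F"
proof -
  obtain c where c: "0 < c" "c < 1"
    and sep: "\<And>k y \<rho>. y \<in> F \<Longrightarrow> 0 < \<rho> \<Longrightarrow> \<rho> < 1 \<Longrightarrow>
       \<exists>S \<subseteq> F \<inter> cball y \<rho>. card S = 2 ^ k \<and> (\<forall>p\<in>S. \<forall>q\<in>S. p \<noteq> q \<longrightarrow> c ^ k * \<rho> < dist p q)"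
    using uniformly_perfect_separated_points[OF assms(2)] by metis
  define M where "M = norm (1 :: real^'n)"
  have M: "M > 0" by (simp add: M_def)
  \<comment> \<open>The exponent for which shrinking by \<open>c\<close> is exactly compensated by doubling.\<close>
  define s where "s = ln 2 / ln (1 / c)"
  have s: "s > 0" using c by (simp add: s_def)
  have cs: "(1 / c) powr s = 2"
    using c by (simp add: s_def powr_def)
  define C where "C = 1 / (2 * M powr s)"
  have C: "C > 0" using M by (simp add: C_def)
  have "C * (R / r) powr s \<le> real (covering_number r (cball x R \<inter> F))"
    if R: "0 < R" "R < 1" "0 < r" "x \<in> F" for R r x
  proof -
    \<comment> \<open>At level \<open>Suc k\<close> the separation first drops below the diameter of a cube of side \<open>r\<close>;
      at level \<open>k\<close> no such cube contains two of the points, trivially so if \<open>k = 0\<close>.\<close>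
    obtain n where "c ^ n < r * M / R"
      using real_arch_pow_inv[of "r * M / R" c] c M R by auto
    moreover have "c ^ Suc n \<le> c ^ n"
      using c by (intro power_decreasing) auto
    ultimately have ex: "\<exists>n. c ^ Suc n < r * M / R"
      by (intro exI[of _ n]) linarith
    define k where "k = (LEAST n. c ^ Suc n < r * M / R)"
    have k: "c ^ Suc k < r * M / R"
      unfolding k_def using ex by (rule LeastI_ex)
    have prev: "k = 0 \<or> r * M \<le> c ^ k * R"
    proof (cases k)
      case (Suc j)
      then have "\<not> c ^ Suc j < r * M / R"
        unfolding k_def using not_less_Least by (metis lessI)
      then show ?thesis using Suc R by (simp add: field_simps)
    qed simp
    obtain S where S: "S \<subseteq> F \<inter> cball x R" "card S = 2 ^ k"
      "\<forall>p\<in>S. \<forall>q\<in>S. p \<noteq> q \<longrightarrow> c ^ k * R < dist p q"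
      using sep[of x R k] R by auto
    have "r * M < dist p q" if "p \<in> S" "q \<in> S" "p \<noteq> q" for p q
    proof -
      have "k \<noteq> 0"
      proof
        assume "k = 0"
        then have "card S = 1" using S(2) by simp
        then show False using that by (auto simp: card_1_singleton_iff)
      qed
      then have "r * M \<le> c ^ k * R" using prev by simp
      also have "\<dots> < dist p q" using S(3) that by blast
      finally show ?thesis .
    qed
    then have "card S \<le> covering_number r (cball x R \<inter> F)"
      using S(1) R assms(1) unfolding M_def
      by (intro card_separated_le_covering_number) (auto intro!: compact_Int)
    then have count: "2 ^ k \<le> real (covering_number r (cball x R \<inter> F))"
      unfolding S(2) by (metis of_nat_mono of_nat_numeral of_nat_power)
    have "R / (r * M) \<le> (1 / c) ^ Suc k"
      using k c M R by (simp add: field_simps)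
    then have "(R / (r * M)) powr s \<le> ((1 / c) ^ Suc k) powr s"
      using s M R by (intro powr_mono2) auto
    also have "\<dots> = ((1 / c) powr s) ^ Suc k"
      using c by (simp add: powr_powr powr_realpow[symmetric] mult.commute del: power_Suc)
    also have "\<dots> = 2 * 2 ^ k"
      by (simp add: cs)
    finally have "(R / r) powr s / M powr s \<le> 2 * 2 ^ k"
      using R M by (simp add: powr_divide powr_mult)
    then have "C * (R / r) powr s \<le> 2 ^ k"
      by (simp add: C_def)
    then show ?thesis using count by linarith
  qed
  then have "ereal s \<le> lower_dim F"
    unfolding lower_dim_def using s C
    by (intro Sup_upper CollectI exI[of _ s] conjI exI[of _ C]) auto
  moreover have "0 < ereal s" using s by simp
  ultimately show ?thesis by (rule less_le_trans[rotated])
qed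

section \<open>Singletons in the gallery\<close>

lemma dist_le_hausdorff_dist_singleton:
  assumes "bounded D" "p \<in> D"
  shows "dist p x \<le> hausdorff_dist D {x}"
proof -
  obtain B where "\<forall>q\<in>D. dist x q \<le> B"
    using assms(1) by (metis bounded_any_center)
  then have "bdd_above ((\<lambda>q. dist q x) ` D)"
    by (intro bdd_aboveI[of _ B]) (auto simp: dist_commute)
  then have "dist p x \<le> (SUP q\<in>D. dist q x)"
    using assms(2) by (rule cSUP_upper[rotated])
  then show ?thesis
    by (simp add: hausdorff_dist_def)
qed

lemma hausdorff_dist_singleton_le:
  assumes "D \<noteq> {}" "D \<subseteq> cball x \<eta>"
  shows "hausdorff_dist D {x} \<le> \<eta>"
proof -
  obtain p where "p \<in> D" using assms(1) by blast
  then have "infdist x D \<le> dist x p" "dist x p \<le> \<eta>"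
    using assms(2) by (auto intro: infdist_le)
  moreover have "(SUP q\<in>D. dist q x) \<le> \<eta>"
    using assms by (intro cSUP_least) (auto simp: dist_commute)
  ultimately show ?thesis
    by (simp add: hausdorff_dist_def)
qed

lemma hausdorff_dist_singleton_nonneg: "0 \<le> hausdorff_dist D {x}"
  by (simp add: hausdorff_dist_def infdist_nonneg le_max_iff_disj)

lemma dist_affine:
  fixes y z t :: "'a::real_normed_vector"
  assumes "l \<ge> 0"
  shows "dist (l *\<^sub>R y + t) (l *\<^sub>R z + t) = l * dist y z"
proof -
  have "l *\<^sub>R y + t - (l *\<^sub>R z + t) = l *\<^sub>R (y - z)"
    by (simp add: algebra_simps)
  then show ?thesis using assms by (simp add: dist_norm)
qed

lemma not_uniformly_perfect_if_singleton_in_gallery: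
  fixes F :: "(real^'n) set"
  assumes "{x} \<in> gallery F"
  shows "\<not> uniformly_perfect F"
proof
  assume "uniformly_perfect F"
  then obtain e where e: "e > 0"
    "\<And>y \<rho>. y \<in> F \<Longrightarrow> 0 < \<rho> \<Longrightarrow> \<rho> < 1 \<Longrightarrow> \<exists>z\<in>F. e * \<rho> < dist y z \<and> dist y z \<le> \<rho>"
    unfolding uniformly_perfect_def by blast
  obtain D where D: "\<And>n. is_miniset F (D n)" and lim: "(\<lambda>n. hausdorff_dist (D n) {x}) \<longlonglongrightarrow> 0"
    and x: "x \<in> interior unit_cube"
    using assms unfolding gallery_def is_microset_def by auto
  obtain d where d: "d > 0" "cball x d \<subseteq> unit_cube"
    using x by (auto simp: mem_interior_cball)
  \<comment> \<open>A ball of radius \<open>\<delta>\<close> about a point within \<open>\<delta>\<close> of \<open>x\<close> stays inside the cube, and points within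
    \<open>\<eta>\<close> of \<open>x\<close> are within \<open>e * \<delta>\<close> of each other.\<close>
  define \<delta> where "\<delta> = min (d / 2) (1 / 2)"
  have \<delta>: "0 < \<delta>" "\<delta> < 1" "2 * \<delta> \<le> d" using d(1) by (auto simp: \<delta>_def)
  define \<eta> where "\<eta> = min \<delta> (e * \<delta> / 2)"
  have \<eta>: "0 < \<eta>" "\<eta> \<le> \<delta>" "2 * \<eta> \<le> e * \<delta>" using \<delta> e(1) by (auto simp: \<eta>_def)
  obtain n where n: "hausdorff_dist (D n) {x} < \<eta>"
    using order_tendstoD(2)[OF lim \<eta>(1)] by (auto simp: eventually_sequentially)
  obtain l t where l: "l \<ge> 1" and Dn: "D n = (\<lambda>y. l *\<^sub>R y + t) ` F \<inter> unit_cube"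
    and cpt: "D n \<in> cpt_space"
    using D[of n] unfolding is_miniset_def by blast
  have "bounded (D n)" "D n \<noteq> {}"
    using cpt by (auto simp: cpt_space_def compact_imp_bounded)
  then have near: "dist p x \<le> \<eta>" if "p \<in> D n" for p
    using dist_le_hausdorff_dist_singleton[of "D n" p x] that n by simp
  obtain p where "p \<in> D n"
    using \<open>D n \<noteq> {}\<close> by blast
  then obtain y where y: "y \<in> F" "l *\<^sub>R y + t \<in> D n"
    using Dn by auto
  have "0 < \<delta> / l" "\<delta> / l < 1"
    using \<delta> l by (auto simp: field_simps)
  then obtain z where z: "z \<in> F" "e * (\<delta> / l) < dist y z" "dist y z \<le> \<delta> / l"
    using e(2)[of y "\<delta> / l"] y by blast
  let ?p = "l *\<^sub>R y + t" and ?q = "l *\<^sub>R z + t"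
  have pq: "dist ?p ?q = l * dist y z"
    using l by (intro dist_affine) auto
  have "dist ?p ?q \<le> \<delta>"
    unfolding pq using z(3) l by (simp add: field_simps)
  moreover have "dist ?p x \<le> \<eta>"
    using near y(2) .
  moreover have "dist x ?q \<le> dist ?p x + dist ?p ?q"
    by (metis dist_commute dist_triangle)
  ultimately have "?q \<in> cball x d"
    using \<eta> \<delta> by simp
  then have "?q \<in> D n"
    using d(2) z(1) Dn by auto
  then have "dist ?p ?q \<le> 2 * \<eta>"
    using near[of ?p] near[of ?q] y(2) dist_triangle2[of ?p ?q x] by linarith
  moreover have "e * \<delta> < dist ?p ?q"
    unfolding pq using z(2) l by (simp add: field_simps)
  ultimately show False
    using \<eta>(3) by linarith
qed

text \<open>An empty annulus about \<open>y\<close>, enlarged so that its outer ball contains the unit cube while \<open>y\<close>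
  moves to the centre, produces a miniset near the centre.\<close>

lemma miniset_near_centre_if_not_uniformly_perfect:
  fixes F :: "(real^'n) set"
  assumes "compact F" "\<not> uniformly_perfect F" "\<eta> > 0"
  shows "\<exists>D. is_miniset F D \<and> D \<subseteq> cball ((1 / 2) *\<^sub>R 1) \<eta>"
proof -
  let ?c = "(1 / 2) *\<^sub>R (1 :: real^'n)"
  have "bounded (unit_cube :: (real^'n) set)"
    by (simp add: unit_cube_def)
  then obtain B where B: "\<forall>p\<in>unit_cube. dist ?c p \<le> B"
    by (metis bounded_any_center)
  define M where "M = max B 1"
  have M: "M \<ge> 1" "\<And>p. p \<in> unit_cube \<Longrightarrow> dist ?c p \<le> M"
    using B by (auto simp: M_def max_def intro: order_trans)
  obtain y \<rho> where y: "y \<in> F" "0 < \<rho>" "\<rho> < 1" "F \<inter> cball y \<rho> \<subseteq> cball y (\<eta> / M * \<rho>)"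
    using not_uniformly_perfectE[OF assms(2), of "\<eta> / M"] assms(3) M(1) by auto
  define l where "l = M / \<rho>"
  have l: "l \<ge> 1" "l * \<rho> = M"
    using M(1) y by (auto simp: l_def field_simps)
  define t where "t = ?c - l *\<^sub>R y"
  have ty: "l *\<^sub>R y + t = ?c" by (simp add: t_def)
  let ?D = "(\<lambda>z. l *\<^sub>R z + t) ` F \<inter> unit_cube"
  have "?c \<in> unit_cube"
    by (simp add: unit_cube_def mem_box_cart)
  then have "?D \<noteq> {}"
    using y(1) ty by (metis IntI empty_iff image_eqI)
  moreover have "compact ?D"
    using assms(1) by (intro compact_Int compact_continuous_image continuous_intros)
      (auto simp: unit_cube_def)
  ultimately have "is_miniset F ?D"
    using l(1) unfolding is_miniset_def cpt_space_def by blast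
  moreover have "?D \<subseteq> cball ?c \<eta>"
  proof
    fix p assume "p \<in> ?D"
    then obtain z where z: "z \<in> F" "p = l *\<^sub>R z + t" "p \<in> unit_cube" by blast
    have cp: "dist ?c p = l * dist y z"
      using dist_affine[of l y t z] l(1) unfolding ty z(2) by simp
    have "l * dist y z \<le> l * \<rho>"
      using M(2)[OF z(3)] cp l(2) by simp
    then have "dist y z \<le> \<rho>"
      using l(1) by simp
    then have "dist y z \<le> \<eta> / M * \<rho>"
      using y(4) z(1) by auto
    then have "l * dist y z \<le> l * (\<eta> / M * \<rho>)"
      using l(1) by (intro mult_left_mono) auto
    also have "\<dots> = \<eta>"
      using M(1) l(2) by (simp add: field_simps)
    finally show "p \<in> cball ?c \<eta>"
      using cp by simp
  qed
  ultimately show ?thesis by blast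
qed

lemma singleton_in_gallery_if_not_uniformly_perfect:
  fixes F :: "(real^'n) set"
  assumes "compact F" "\<not> uniformly_perfect F"
  shows "{(1 / 2) *\<^sub>R 1} \<in> gallery F"
proof -
  let ?c = "(1 / 2) *\<^sub>R (1 :: real^'n)"
  have "\<forall>n. \<exists>D. is_miniset F D \<and> D \<subseteq> cball ?c (inverse (real (Suc n)))"
    using miniset_near_centre_if_not_uniformly_perfect[OF assms] by simp
  then obtain D where D: "\<And>n. is_miniset F (D n)"
    "\<And>n. D n \<subseteq> cball ?c (inverse (real (Suc n)))"
    by metis
  have "hausdorff_dist (D n) {?c} \<le> inverse (real (Suc n))" for n
    using D[of n] by (intro hausdorff_dist_singleton_le) (auto simp: is_miniset_def cpt_space_def)
  then have "(\<lambda>n. hausdorff_dist (D n) {?c}) \<longlonglongrightarrow> 0"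
    by (intro tendsto_sandwich[OF _ _ tendsto_const LIMSEQ_inverse_real_of_nat])
      (auto simp: hausdorff_dist_singleton_nonneg)
  moreover have inner: "?c \<in> interior unit_cube"
    by (simp add: unit_cube_def interior_cbox mem_box_cart)
  moreover have "{?c} \<in> cpt_space"
    using inner interior_subset by (auto simp: cpt_space_def)
  ultimately show ?thesis
    using D(1) unfolding gallery_def is_microset_def by blast
qed

theorem theorem1p4:
  fixes F :: "(real^'n) set"
  assumes "compact F"
  shows "(\<exists>x. {x} \<in> gallery F) \<longleftrightarrow> lower_dim F = 0"
proof -
  have "(\<exists>x. {x} \<in> gallery F) \<longleftrightarrow> \<not> uniformly_perfect F"
    using not_uniformly_perfect_if_singleton_in_gallery
      singleton_in_gallery_if_not_uniformly_perfect[OF assms] by blast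
  also have "\<dots> \<longleftrightarrow> lower_dim F = 0"
    using lower_dim_eq_0_if_not_uniformly_perfect[OF assms]
      lower_dim_pos_if_uniformly_perfect[OF assms] by auto
  finally show ?thesis .
qed

end
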